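(* The forward Born series $$u=u_0+\sum_{n=1}^\infty K_n(\zeta,\dots,\zeta)$$ converges in $C(\overline\Omega)$ for $$\|\zeta\|_\infty\le\frac{1}{K\mu},$$ where $\mu=k^2\sup_{x\in\Omega}\int_\Omega|G(x,y)|\,dy$ and $\nu,K$ ($K>0$) are constants, depending on $\nu_0=\|u_0\|_{C(\overline\Omega)}$ but not on $n$, such that $\nu_n\le\nu K^n$ for all $n\ge0$, the sequence $\{\nu_n\}$ being defined by its initial value $\nu_0$ and $$\nu_{n+1}=\nu_n+\sum_{\substack{(i_1,i_2,i_3)\\ i_1+i_2+i_3=n\\ 0\le i_1,i_2,i_3\le n}}\nu_{i_1}\nu_{i_2}\nu_{i_3},\qquad n\ge0.$$
   Context: $\Omega\subset\mathbb{R}^d$, $d>2$, is a bounded domain with smooth boundary, $k>0$, and $u_0\in C(\overline\Omega)$ is real valued and solves $\Delta u_0+k^2u_0=0$ in $\Omega$, $\partial u_0/\partial\nu=g$ on $\partial\Omega$ for a given real source $g$. $G$ is the Green's function: $\Delta_xG(x,y)+k^2G(x,y)=\delta(x-y)$ in $\Omega$, $\partial G/\partial\nu_y=0$ on $\partial\Omega$ (assumed to exist). $\zeta=(\alpha,\beta)\in[L^\infty(\Omega)]^2$ is a pair of real-valued coefficients, with $\|\zeta\|_\infty=\max(\|\alpha\|_\infty,\|\beta\|_\infty)$. A multilinear operator of order $l$ is an $l$-linear map $T_l:([L^\infty(\Omega)]^2)^l\to C(\overline\Omega)$; order-zero operators are elements of $C(\overline\Omega)$. For $v\in C(\overline\Omega)$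 set $a(v,\zeta)(x)=-k^2\int_\Omega G(x,y)\alpha(y)v(y)\,dy$ and $b(v,\zeta)(x)=-k^2\int_\Omega G(x,y)\beta(y)v(y)\,dy$. For $T_l$ of order $l$, define operators of order $l+1$ by $AT_l(\zeta_1,\dots,\zeta_{l+1})=a(T_l(\zeta_1,\dots,\zeta_l),\zeta_{l+1})$ and $BT_l(\zeta_1,\dots,\zeta_{l+1})=b(T_l(\zeta_1,\dots,\zeta_l),\zeta_{l+1})$. The tensor product is the pointwise product $T_l\otimes T_j(\zeta_1,\dots,\zeta_{l+j})=T_l(\zeta_1,\dots,\zeta_l)T_j(\zeta_{l+1},\dots,\zeta_{l+j})$. The forward operators are defined by $K_0=u_0$ and, for $n\ge0$, $$K_{n+1}=AK_n+B\sum_{\substack{(i_1,i_2,i_3)\\ i_1+i_2+i_3=n\\ 0\le i_1,i_2,i_3\le n}}K_{i_1}\otimes K_{i_2}\otimes K_{i_3}$$ ($B$ applied to the whole sum), so $K_n$ has order $n$. *)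

theory Defs
  imports "HOL-Analysis.Analysis" "HOL-Probability.Essential_Supremum"
begin

section \<open>Smooth functions, Laplacian, smooth boundary\<close>

text \<open>Intended for open \<open>S\<close>, where \<open>frechet_derivative f (at x) i\<close> is the directional derivative
  of \<open>f\<close> at \<open>x\<close> in the direction \<open>i\<close>.\<close>

fun Ck_on :: "nat \<Rightarrow> 'a::euclidean_space set \<Rightarrow> ('a \<Rightarrow> real) \<Rightarrow> bool" where
  "Ck_on 0 S f \<longleftrightarrow> continuous_on S f"
| "Ck_on (Suc n) S f \<longleftrightarrow>
     (\<forall>x\<in>S. f differentiable (at x)) \<and>
     (\<forall>i\<in>Basis. Ck_on n S (\<lambda>x. frechet_derivative f (at x) i))"

definition smooth_on :: "'a::euclidean_space set \<Rightarrow> ('a \<Rightarrow> real) \<Rightarrow> bool" where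
  "smooth_on S f \<longleftrightarrow> (\<forall>n. Ck_on n S f)"

definition laplacian :: "('a::euclidean_space \<Rightarrow> real) \<Rightarrow> 'a \<Rightarrow> real" where
  "laplacian f x =
     (\<Sum>i\<in>Basis. frechet_derivative (\<lambda>z. frechet_derivative f (at z) i) (at x) i)"

text \<open>Near the boundary point \<open>p\<close>, the set is the sublevel set of a smooth \<open>\<phi>\<close> with
  \<open>\<nabla>\<phi>(p) = w \<noteq> 0\<close>; hence \<open>w / |w|\<close> is the outward unit normal.\<close>

definition outward_unit_normal :: "'a::euclidean_space set \<Rightarrow> 'a \<Rightarrow> 'a \<Rightarrow> bool" where
  "outward_unit_normal \<Omega> p n \<longleftrightarrow>
     p \<in> frontier \<Omega> \<and>
     (\<exists>U \<phi> w. open U \<and> p \<in> U \<and> smooth_on U \<phi> \<and> GDERIV \<phi> p :> w \<and> w \<noteq> 0 \<and>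
        \<Omega> \<inter> U = {x \<in> U. \<phi> x < 0} \<and> n = sgn w)"

definition smooth_boundary :: "'a::euclidean_space set \<Rightarrow> bool" where
  "smooth_boundary \<Omega> \<longleftrightarrow> (\<forall>p\<in>frontier \<Omega>. \<exists>n. outward_unit_normal \<Omega> p n)"

definition smooth_bounded_domain :: "'a::euclidean_space set \<Rightarrow> bool" where
  "smooth_bounded_domain \<Omega> \<longleftrightarrow>
     open \<Omega> \<and> connected \<Omega> \<and> \<Omega> \<noteq> {} \<and> bounded \<Omega> \<and> smooth_boundary \<Omega>"

text \<open>One-sided derivative along the normal, since \<open>f\<close> is only meaningful on \<open>closure \<Omega>\<close>.\<close>

definition has_normal_derivative ::
    "'a::euclidean_space set \<Rightarrow> ('a \<Rightarrow> real) \<Rightarrow> real \<Rightarrow> 'a \<Rightarrow> bool" where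
  "has_normal_derivative \<Omega> f D p \<longleftrightarrow>
     (\<exists>n. outward_unit_normal \<Omega> p n \<and>
        ((\<lambda>t. f (p + t *\<^sub>R n)) has_real_derivative D) (at 0 within {..0}))"


section \<open>The background field and the Green's function\<close>

definition background_field ::
    "'a::euclidean_space set \<Rightarrow> real \<Rightarrow> ('a \<Rightarrow> real) \<Rightarrow> ('a \<Rightarrow> real) \<Rightarrow> bool" where
  "background_field \<Omega> k g u0 \<longleftrightarrow>
     continuous_on (closure \<Omega>) u0 \<and> Ck_on 2 \<Omega> u0 \<and>
     (\<forall>x\<in>\<Omega>. laplacian u0 x + k\<^sup>2 * u0 x = 0) \<and>
     (\<forall>p\<in>frontier \<Omega>. has_normal_derivative \<Omega> u0 (g p) p)"

definition test_function :: "'a::euclidean_space set \<Rightarrow> ('a \<Rightarrow> real) \<Rightarrow> bool" where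
  "test_function \<Omega> \<phi> \<longleftrightarrow>
     smooth_on UNIV \<phi> \<and> compact (closure {x. \<phi> x \<noteq> 0}) \<and> closure {x. \<phi> x \<noteq> 0} \<subseteq> \<Omega>"

text \<open>The equation \<open>\<Delta>\<^sub>x G(x,y) + k\<^sup>2 G(x,y) = \<delta>(x - y)\<close> is understood in the sense of distributions
  in \<open>x\<close>.\<close>

definition greens_function ::
    "'a::euclidean_space set \<Rightarrow> real \<Rightarrow> ('a \<Rightarrow> 'a \<Rightarrow> real) \<Rightarrow> bool" where
  "greens_function \<Omega> k G \<longleftrightarrow>
     (\<forall>y\<in>\<Omega>.
        (\<forall>C. compact C \<and> C \<subseteq> \<Omega> \<longrightarrow> integrable (lebesgue_on C) (\<lambda>x. G x y)) \<and>
        (\<forall>\<phi>. test_function \<Omega> \<phi> \<longrightarrow>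
           (\<integral>x. G x y * (laplacian \<phi> x + k\<^sup>2 * \<phi> x) \<partial>(lebesgue_on \<Omega>)) = \<phi> y)) \<and>
     (\<forall>x\<in>\<Omega>. \<forall>y\<in>frontier \<Omega>. has_normal_derivative \<Omega> (G x) 0 y)"


section \<open>Coefficients and norms\<close>

text \<open>Elements of \<open>L\<^sup>\<infinity>\<close> are represented by measurable functions; all integrals below depend
  only on their classes.\<close>

definition Linf_norm :: "'a::euclidean_space set \<Rightarrow> ('a \<Rightarrow> real) \<Rightarrow> ennreal" where
  "Linf_norm \<Omega> f = esssup (lebesgue_on \<Omega>) (\<lambda>x. ennreal \<bar>f x\<bar>)"

definition Linf :: "'a::euclidean_space set \<Rightarrow> ('a \<Rightarrow> real) set" where
  "Linf \<Omega> = {f \<in> borel_measurable (lebesgue_on \<Omega>). Linf_norm \<Omega> f < \<infinity>}"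

type_synonym 'a coeff = "('a \<Rightarrow> real) \<times> ('a \<Rightarrow> real)"

definition coeff_norm :: "'a::euclidean_space set \<Rightarrow> 'a coeff \<Rightarrow> ennreal" where
  "coeff_norm \<Omega> \<zeta> = max (Linf_norm \<Omega> (fst \<zeta>)) (Linf_norm \<Omega> (snd \<zeta>))"

definition C_norm :: "'a::euclidean_space set \<Rightarrow> ('a \<Rightarrow> real) \<Rightarrow> real" where
  "C_norm \<Omega> v = (SUP x\<in>closure \<Omega>. \<bar>v x\<bar>)"


section \<open>Multilinear operators and the forward operators\<close>

text \<open>An operator of order \<open>l\<close> is represented as a function of the list \<open>[\<zeta>\<^sub>1, \<dots>, \<zeta>\<^sub>l]\<close> of its
  arguments; only lists of length \<open>l\<close> are relevant.\<close>

type_synonym 'a multiop = "'a coeff list \<Rightarrow> 'a \<Rightarrow> real"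

definition a_op :: "'a::euclidean_space set \<Rightarrow> real \<Rightarrow> ('a \<Rightarrow> 'a \<Rightarrow> real) \<Rightarrow>
    ('a \<Rightarrow> real) \<Rightarrow> 'a coeff \<Rightarrow> 'a \<Rightarrow> real" where
  "a_op \<Omega> k G v \<zeta> x = - k\<^sup>2 * (\<integral>y. G x y * fst \<zeta> y * v y \<partial>(lebesgue_on \<Omega>))"

definition b_op :: "'a::euclidean_space set \<Rightarrow> real \<Rightarrow> ('a \<Rightarrow> 'a \<Rightarrow> real) \<Rightarrow>
    ('a \<Rightarrow> real) \<Rightarrow> 'a coeff \<Rightarrow> 'a \<Rightarrow> real" where
  "b_op \<Omega> k G v \<zeta> x = - k\<^sup>2 * (\<integral>y. G x y * snd \<zeta> y * v y \<partial>(lebesgue_on \<Omega>))"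

definition A_op :: "'a::euclidean_space set \<Rightarrow> real \<Rightarrow> ('a \<Rightarrow> 'a \<Rightarrow> real) \<Rightarrow>
    'a multiop \<Rightarrow> 'a multiop" where
  "A_op \<Omega> k G T zs = a_op \<Omega> k G (T (butlast zs)) (last zs)"

definition B_op :: "'a::euclidean_space set \<Rightarrow> real \<Rightarrow> ('a \<Rightarrow> 'a \<Rightarrow> real) \<Rightarrow>
    'a multiop \<Rightarrow> 'a multiop" where
  "B_op \<Omega> k G T zs = b_op \<Omega> k G (T (butlast zs)) (last zs)"

text \<open>\<open>l\<close> is the order of the left factor.\<close>

definition tensor :: "nat \<Rightarrow> 'a multiop \<Rightarrow> 'a multiop \<Rightarrow> 'a multiop" where
  "tensor l T S zs x = T (take l zs) x * S (drop l zs) x"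

definition triples :: "nat \<Rightarrow> (nat \<times> nat \<times> nat) set" where
  "triples n = {(i, j, l). i + j + l = n \<and> i \<le> n \<and> j \<le> n \<and> l \<le> n}"

lemma finite_triples: "finite (triples n)"
  by (rule finite_subset[of _ "{..n} \<times> {..n} \<times> {..n}"]) (auto simp: triples_def)

function forward_op :: "'a::euclidean_space set \<Rightarrow> real \<Rightarrow> ('a \<Rightarrow> 'a \<Rightarrow> real) \<Rightarrow>
    ('a \<Rightarrow> real) \<Rightarrow> nat \<Rightarrow> 'a multiop" where
  "forward_op \<Omega> k G u0 0 = (\<lambda>zs. u0)"
| "forward_op \<Omega> k G u0 (Suc n) = (\<lambda>zs x.
     A_op \<Omega> k G (forward_op \<Omega> k G u0 n) zs x +
     B_op \<Omega> k G (\<lambda>ws y. \<Sum>(i, j, l)\<in>triples n.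
         tensor (i + j)
           (tensor i (forward_op \<Omega> k G u0 i) (forward_op \<Omega> k G u0 j))
           (forward_op \<Omega> k G u0 l) ws y) zs x)"
  by pat_completeness auto
termination
  by (relation "Wellfounded.measure (\<lambda>(\<Omega>, k, G, u0, n). n)") (auto simp: triples_def)


section \<open>Constants\<close>

text \<open>Taken in \<open>ennreal\<close> so that the supremum is meaningful without a finiteness assumption
  (and \<open>1 / \<infinity> = 0\<close>).\<close>

definition mu :: "'a::euclidean_space set \<Rightarrow> real \<Rightarrow> ('a \<Rightarrow> 'a \<Rightarrow> real) \<Rightarrow> ennreal" where
  "mu \<Omega> k G = ennreal (k\<^sup>2) * (SUP x\<in>\<Omega>. \<integral>\<^sup>+y. ennreal \<bar>G x y\<bar> \<partial>(lebesgue_on \<Omega>))"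

function nu_seq :: "real \<Rightarrow> nat \<Rightarrow> real" where
  "nu_seq \<nu>0 0 = \<nu>0"
| "nu_seq \<nu>0 (Suc n) = nu_seq \<nu>0 n +
     (\<Sum>(i, j, l)\<in>triples n. nu_seq \<nu>0 i * nu_seq \<nu>0 j * nu_seq \<nu>0 l)"
  by pat_completeness auto
termination
  by (relation "Wellfounded.measure (\<lambda>(\<nu>0, n). n)") (auto simp: triples_def)

end

theory Submission
  imports Defs
begin

text \<open>Each application of \<open>A\<close> or \<open>B\<close> costs a factor \<open>\<mu>\<parallel>\<zeta>\<parallel> \<le> t = 1/K\<close>, so
  \<open>\<parallel>K\<^sub>n(\<zeta>,\<dots>,\<zeta>)\<parallel> \<le> \<nu>\<^sub>n t\<^sup>n\<close>, and it remains to sum \<open>\<nu>\<^sub>n t\<^sup>n\<close>. The bound \<open>\<nu>\<^sub>n \<le> \<nu> K\<^sup>n\<close> alone gives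
  this only for parameters \<open>s < t\<close>. There the generating function satisfies
  \<open>F(s) = \<nu>\<^sub>0 + s (F(s) + F(s)\<^sup>3)\<close>, hence \<open>s F(s)\<^sup>3 \<le> F(s)\<close> and \<open>s F(s)\<^sup>2 \<le> 1\<close>. This estimate is uniform
  as \<open>s\<close> increases to \<open>t\<close>, so the series still converges at the endpoint.
  Conversely, \<open>\<nu>\<^sub>0 + s (M + M\<^sup>3) \<le> M\<close> for \<open>M = \<nu>\<^sub>0 + 1\<close> and small \<open>s\<close> bounds all partial sums of \<open>F(s)\<close>
  by \<open>M\<close>, which gives suitable \<open>\<nu>\<close> and \<open>K\<close>.\<close>

section \<open>Cubes of partial sums and triple convolutions\<close>

lemma cube_sum_conv_Times:
  fixes a :: "nat \<Rightarrow> real"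
  shows "(\<Sum>i\<le>N. a i) ^ 3 = (\<Sum>(i, j, l)\<in>{..N} \<times> {..N} \<times> {..N}. a i * a j * a l)"
proof -
  have "(\<Sum>i\<le>N. a i) ^ 3 = (\<Sum>i\<le>N. a i) * ((\<Sum>j\<le>N. a j) * (\<Sum>l\<le>N. a l))"
    by (simp add: power3_eq_cube)
  also have "\<dots> = (\<Sum>i\<le>N. \<Sum>j\<le>N. \<Sum>l\<le>N. a i * a j * a l)"
    unfolding sum_product by (simp only: sum_distrib_left mult.assoc)
  finally show ?thesis
    by (simp add: sum.cartesian_product)
qed

lemma sum_triples_conv_UN:
  "(\<Sum>n\<le>N. \<Sum>p\<in>triples n. f p) = (\<Sum>p\<in>(\<Union>n\<le>N. triples n). f p)"
  by (rule sum.UNION_disjoint [symmetric]) (auto simp: finite_triples, auto simp: triples_def)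

text \<open>Every triple with index sum at most \<open>N\<close> lies in the box of side
  \<open>N\<close> over which the expanded cube runs; by nonnegativity, the additional terms of the
  box only enlarge the sum.\<close>

lemma sum_triples_le_cube:
  fixes a :: "nat \<Rightarrow> real"
  assumes "\<And>i. a i \<ge> 0"
  shows "(\<Sum>n\<le>N. \<Sum>(i, j, l)\<in>triples n. a i * a j * a l) \<le> (\<Sum>i\<le>N. a i) ^ 3"
  unfolding cube_sum_conv_Times sum_triples_conv_UN
  by (rule sum_mono2) (auto simp: assms triples_def)

text \<open>Conversely, a triple in the box of side \<open>N\<close> has index sum at most
  \<open>3 * N\<close>. This factor 3 is the price of a lower bound with finite sums only.\<close>

lemma cube_le_sum_triples:
  fixes a :: "nat \<Rightarrow> real"
  assumes "\<And>i. a i \<ge> 0"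
  shows "(\<Sum>i\<le>N. a i) ^ 3 \<le> (\<Sum>n\<le>3 * N. \<Sum>(i, j, l)\<in>triples n. a i * a j * a l)"
  unfolding cube_sum_conv_Times sum_triples_conv_UN
  by (rule sum_mono2) (auto simp: assms finite_triples, auto simp: triples_def)

section \<open>The majorant sequence and its generating function\<close>

lemma nu_seq_nonneg:
  assumes "c \<ge> 0"
  shows "nu_seq c n \<ge> 0"
proof (induction n rule: less_induct)
  case (less n)
  then show ?case
    by (cases n) (auto simp: assms triples_def intro!: add_nonneg_nonneg sum_nonneg mult_nonneg_nonneg)
qed

text \<open>Since \<open>i + j + l = n\<close> on \<open>triples n\<close>, the factor
  \<open>t ^ n\<close> splits over the three factors. The weighted terms thus obey the same
  recursion, with one extra factor \<open>t\<close>.\<close>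

lemma nu_seq_Suc_weighted:
  "nu_seq c (Suc n) * t ^ Suc n = t * (nu_seq c n * t ^ n +
     (\<Sum>(i, j, l)\<in>triples n. (nu_seq c i * t ^ i) * (nu_seq c j * t ^ j) * (nu_seq c l * t ^ l)))"
proof -
  have "(\<Sum>(i, j, l)\<in>triples n. nu_seq c i * nu_seq c j * nu_seq c l) * t ^ n =
      (\<Sum>(i, j, l)\<in>triples n. (nu_seq c i * t ^ i) * (nu_seq c j * t ^ j) * (nu_seq c l * t ^ l))"
    unfolding sum_distrib_right by (rule sum.cong) (auto simp: triples_def power_add)
  then show ?thesis
    by (simp add: algebra_simps)
qed

text \<open>Truncations of the generating function F at \<open>t\<close>, with \<open>c\<close> as
  initial value. They are meaningful before any convergence is known.\<close>

definition nu_psum :: "real \<Rightarrow> real \<Rightarrow> nat \<Rightarrow> real" where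
  "nu_psum c t N = (\<Sum>n\<le>N. nu_seq c n * t ^ n)"

text \<open>A truncated form of F = c + t (F + F^3): the triple sum stands for the cube, and the two
  preceding comparisons bound it from either side.\<close>

lemma nu_psum_Suc:
  "nu_psum c t (Suc N) = c + t * (nu_psum c t N +
     (\<Sum>n\<le>N. \<Sum>(i, j, l)\<in>triples n. (nu_seq c i * t ^ i) * (nu_seq c j * t ^ j) * (nu_seq c l * t ^ l)))"
  unfolding nu_psum_def sum.atMost_Suc_shift nu_seq_Suc_weighted
  by (simp add: sum_distrib_left sum.distrib distrib_left)

lemma nu_psum_nonneg: "c \<ge> 0 \<Longrightarrow> t \<ge> 0 \<Longrightarrow> nu_psum c t N \<ge> 0"
  unfolding nu_psum_def by (intro sum_nonneg mult_nonneg_nonneg nu_seq_nonneg) auto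

text \<open>The map X -> c + t (X + X^3) is monotone on nonnegative reals and does not raise
  \<open>M\<close>, so iterating the recursion from \<open>c\<close> never exceeds
  \<open>M\<close>.\<close>

lemma nu_psum_bounded:
  assumes "c \<ge> 0" "t \<ge> 0" "c \<le> M" "c + t * (M + M ^ 3) \<le> M"
  shows "nu_psum c t N \<le> M"
proof (induction N)
  case 0
  then show ?case using assms by (simp add: nu_psum_def)
next
  case (Suc N)
  have "nu_psum c t (Suc N) \<le> c + t * (nu_psum c t N + nu_psum c t N ^ 3)"
    unfolding nu_psum_Suc
    by (intro add_left_mono mult_left_mono assms, unfold nu_psum_def, rule sum_triples_le_cube)
       (simp add: assms nu_seq_nonneg)
  also have "\<dots> \<le> c + t * (M + M ^ 3)"
    using Suc by (intro add_left_mono mult_left_mono add_mono power_mono nu_psum_nonneg assms)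
  also have "\<dots> \<le> M"
    by (rule assms)
  finally show ?case .
qed

lemma nu_seq_exponential_bound:
  assumes "c \<ge> 0"
  shows "\<exists>\<nu> K. K > 0 \<and> (\<forall>n. nu_seq c n \<le> \<nu> * K ^ n)"
proof -
  define M where "M = c + 1"
  \<comment> \<open>Chosen so that at t = 1/K the value c + t (M + M^3) is c + 1, which is exactly
    \<open>M\<close>.\<close>
  define K where "K = M + M ^ 3"
  have "M > 0"
    using assms by (simp add: M_def)
  then have K: "K > 0"
    by (simp add: K_def add_pos_pos)
  have "nu_seq c n \<le> M * K ^ n" for n
  proof -
    have "nu_seq c n * (1 / K) ^ n \<le> nu_psum c (1 / K) n"
      unfolding nu_psum_def
      by (rule member_le_sum) (use assms K in \<open>auto simp: nu_seq_nonneg\<close>)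
    also have "\<dots> \<le> M"
      by (rule nu_psum_bounded) (use assms K in \<open>auto simp: M_def K_def\<close>)
    finally show ?thesis
      using K by (simp add: power_one_over field_simps)
  qed
  then show ?thesis
    using K by blast
qed

lemma cube_nu_psum_le:
  assumes "c \<ge> 0" "t \<ge> 0"
  shows "t * nu_psum c t N ^ 3 \<le> nu_psum c t (Suc (3 * N))"
proof -
  have "nu_psum c t N ^ 3 \<le> (\<Sum>n\<le>3 * N. \<Sum>(i, j, l)\<in>triples n.
      (nu_seq c i * t ^ i) * (nu_seq c j * t ^ j) * (nu_seq c l * t ^ l))"
    unfolding nu_psum_def by (rule cube_le_sum_triples) (simp add: assms nu_seq_nonneg)
  then have "t * nu_psum c t N ^ 3 \<le> t * (nu_psum c t (3 * N) + \<dots>)"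
    by (intro mult_left_mono assms add_increasing nu_psum_nonneg)
  then show ?thesis
    unfolding nu_psum_Suc using \<open>c \<ge> 0\<close> by linarith
qed

lemma nu_psum_sq_le_inside:
  assumes "c \<ge> 0" "K > 0" "\<And>n. nu_seq c n \<le> \<nu> * K ^ n" "0 < s" "s < 1 / K"
  shows "s * (nu_psum c s N)\<^sup>2 \<le> 1"
proof -
  have summ: "summable (\<lambda>n. nu_seq c n * s ^ n)"
  proof (rule summable_comparison_test')
    show "summable (\<lambda>n. \<nu> * (K * s) ^ n)"
      using assms by (intro summable_mult summable_geometric) (simp add: field_simps)
    show "norm (nu_seq c n * s ^ n) \<le> \<nu> * (K * s) ^ n" if "n \<ge> 0" for n
      using assms(3)[of n] assms
      by (simp add: nu_seq_nonneg power_mult_distrib mult.assoc [symmetric] mult_right_mono)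
  qed
  define F where "F = (\<Sum>n. nu_seq c n * s ^ n)"
  have lim: "nu_psum c s \<longlonglongrightarrow> F"
    unfolding nu_psum_def [abs_def] F_def
    using summ by (rule summable_LIMSEQ')
  have le: "nu_psum c s N \<le> F" for N
    unfolding nu_psum_def F_def
    by (rule sum_le_suminf [OF summ]) (use assms in \<open>auto simp: nu_seq_nonneg\<close>)
  have nonneg: "nu_psum c s N \<ge> 0" for N
    using assms by (simp add: nu_psum_nonneg)
  \<comment> \<open>The truncated inequality is passed to the limit on its left side only; on its
    right side every partial sum is already at most \<open>F\<close>.\<close>
  have "s * F ^ 3 \<le> F"
  proof (rule LIMSEQ_le_const2)
    show "(\<lambda>N. s * nu_psum c s N ^ 3) \<longlonglongrightarrow> s * F ^ 3"
      by (intro tendsto_intros lim)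
    show "\<exists>N0. \<forall>N\<ge>N0. s * nu_psum c s N ^ 3 \<le> F"
      using assms by (meson cube_nu_psum_le le order_trans less_imp_le)
  qed
  have "F \<ge> 0"
    using le nonneg order_trans by blast
  have "s * F\<^sup>2 \<le> 1"
  proof (cases "F = 0")
    case False
    then have "F > 0" using \<open>F \<ge> 0\<close> by simp
    have "(s * F\<^sup>2) * F \<le> 1 * F"
      using \<open>s * F ^ 3 \<le> F\<close> by (simp add: power2_eq_square power3_eq_cube mult.assoc)
    then show ?thesis
      using \<open>F > 0\<close> by (rule mult_right_le_imp_le)
  qed simp
  moreover have "s * (nu_psum c s N)\<^sup>2 \<le> s * F\<^sup>2"
    using assms le nonneg by (intro mult_left_mono power_mono) auto
  ultimately show ?thesis by linarith
qed

lemma summable_nu_seq_endpoint: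
  assumes "c \<ge> 0" "K > 0" "\<And>n. nu_seq c n \<le> \<nu> * K ^ n"
  shows "summable (\<lambda>n. nu_seq c n * (1 / K) ^ n)"
proof -
  define t where "t = 1 / K"
  have t: "t > 0" using assms by (simp add: t_def)
  \<comment> \<open>For fixed \<open>N\<close> the left side is a polynomial in the parameter, hence
    continuous. The bound holds for all s in (0, t) and survives s -> t from the left.\<close>
  have sq: "t * (nu_psum c t N)\<^sup>2 \<le> 1" for N
  proof (rule tendsto_upperbound)
    show "((\<lambda>s. s * (nu_psum c s N)\<^sup>2) \<longlongrightarrow> t * (nu_psum c t N)\<^sup>2) (at_left t)"
      unfolding nu_psum_def by (intro tendsto_intros)
    show "\<forall>\<^sub>F s in at_left t. s * (nu_psum c s N)\<^sup>2 \<le> 1"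
      using eventually_at_left_real [OF t]
      by eventually_elim (auto intro!: nu_psum_sq_le_inside [OF assms] simp: t_def)
  qed simp
  have "summable (\<lambda>n. nu_seq c n * t ^ n)"
  proof (rule bounded_imp_summable)
    show "nu_seq c n * t ^ n \<ge> 0" for n
      using t assms by (simp add: nu_seq_nonneg)
    \<comment> \<open>As t = 1/K, \<open>sq\<close> says that the square of the partial sum is at
      most \<open>K\<close>.\<close>
    show "(\<Sum>n\<le>N. nu_seq c n * t ^ n) \<le> sqrt K" for N
      using sq [of N] \<open>K > 0\<close> unfolding nu_psum_def
      by (intro real_le_rsqrt) (simp add: t_def field_simps)
  qed
  then show ?thesis
    by (simp add: t_def)
qed

section \<open>Estimates for the integral operators in extended reals\<close>

lemma abs_integral_Linf_le:
  fixes h \<gamma> v :: "'a::euclidean_space \<Rightarrow> real"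
  assumes "\<Omega> \<in> sets lebesgue" "h \<in> borel_measurable (lebesgue_on \<Omega>)"
    and "\<And>y. y \<in> \<Omega> \<Longrightarrow> \<bar>v y\<bar> \<le> c"
  shows "ennreal \<bar>\<integral>y. h y * \<gamma> y * v y \<partial>(lebesgue_on \<Omega>)\<bar> \<le>
    (\<integral>\<^sup>+y. ennreal \<bar>h y\<bar> \<partial>(lebesgue_on \<Omega>)) * Linf_norm \<Omega> \<gamma> * ennreal c"
proof -
  let ?M = "lebesgue_on \<Omega>"
  have "AE y in ?M. ennreal \<bar>\<gamma> y\<bar> \<le> Linf_norm \<Omega> \<gamma>"
    unfolding Linf_norm_def by (rule esssup_AE)
  then have bound: "AE y in ?M. ennreal \<bar>h y * \<gamma> y * v y\<bar> \<le> ennreal \<bar>h y\<bar> * (Linf_norm \<Omega> \<gamma> * ennreal c)"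
    using AE_space
  proof eventually_elim
    case (elim y)
    have "ennreal \<bar>h y * \<gamma> y * v y\<bar> = ennreal \<bar>h y\<bar> * (ennreal \<bar>\<gamma> y\<bar> * ennreal \<bar>v y\<bar>)"
      by (simp add: abs_mult ennreal_mult mult.assoc)
    also have "\<dots> \<le> ennreal \<bar>h y\<bar> * (Linf_norm \<Omega> \<gamma> * ennreal c)"
      using elim assms(3) by (intro mult_left_mono mult_mono) (auto intro: ennreal_leI)
    finally show ?case .
  qed
  have "ennreal \<bar>\<integral>y. h y * \<gamma> y * v y \<partial>?M\<bar> \<le> (\<integral>\<^sup>+y. ennreal \<bar>h y * \<gamma> y * v y\<bar> \<partial>?M)"
    \<comment> \<open>A non-integrable integrand has Bochner integral 0 by convention, so the bound
      is trivial in that case.\<close>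
    using integral_norm_bound_ennreal [of ?M "\<lambda>y. h y * \<gamma> y * v y"]
    by (cases "integrable ?M (\<lambda>y. h y * \<gamma> y * v y)") (auto simp: not_integrable_integral_eq)
  also have "\<dots> \<le> (\<integral>\<^sup>+y. ennreal \<bar>h y\<bar> * (Linf_norm \<Omega> \<gamma> * ennreal c) \<partial>?M)"
    using bound by (rule nn_integral_mono_AE)
  also have "\<dots> = (\<integral>\<^sup>+y. ennreal \<bar>h y\<bar> \<partial>?M) * (Linf_norm \<Omega> \<gamma> * ennreal c)"
    by (rule nn_integral_multc) (use assms in measurable)
  finally show ?thesis by (simp add: mult.assoc)
qed

text \<open>Serves both \<open>a_op\<close> and \<open>b_op\<close>, with \<gamma> one component of
  the coefficient pair. The chain runs in \<open>ennreal\<close> because \<open>mu\<close> may be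
  infinite; the finite bound \<open>t\<close> on the product with the norm allows the return to
  reals.\<close>

lemma abs_integral_operator_le:
  fixes G :: "'a::euclidean_space \<Rightarrow> 'a \<Rightarrow> real"
  assumes "\<Omega> \<in> sets lebesgue" "G x \<in> borel_measurable (lebesgue_on \<Omega>)"
    and "x \<in> \<Omega>" "\<And>y. y \<in> \<Omega> \<Longrightarrow> \<bar>v y\<bar> \<le> c" "c \<ge> 0"
    and "mu \<Omega> k G * Linf_norm \<Omega> \<gamma> \<le> ennreal t" "t \<ge> 0"
  shows "\<bar>- k\<^sup>2 * (\<integral>y. G x y * \<gamma> y * v y \<partial>(lebesgue_on \<Omega>))\<bar> \<le> t * c"
proof -
  let ?I = "\<integral>y. G x y * \<gamma> y * v y \<partial>(lebesgue_on \<Omega>)"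
    and ?J = "\<lambda>x. \<integral>\<^sup>+y. ennreal \<bar>G x y\<bar> \<partial>(lebesgue_on \<Omega>)"
  have "ennreal \<bar>- k\<^sup>2 * ?I\<bar> = ennreal (k\<^sup>2) * ennreal \<bar>?I\<bar>"
    by (simp add: abs_mult ennreal_mult)
  also have "\<dots> \<le> ennreal (k\<^sup>2) * (?J x * Linf_norm \<Omega> \<gamma> * ennreal c)"
    by (intro mult_left_mono abs_integral_Linf_le assms) auto
  also have "\<dots> \<le> ennreal (k\<^sup>2) * ((SUP x\<in>\<Omega>. ?J x) * Linf_norm \<Omega> \<gamma> * ennreal c)"
    by (intro mult_left_mono mult_right_mono SUP_upper assms) auto
  also have "\<dots> = mu \<Omega> k G * Linf_norm \<Omega> \<gamma> * ennreal c"
    by (simp add: mu_def mult.assoc)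
  also have "\<dots> \<le> ennreal t * ennreal c"
    by (intro mult_right_mono assms) auto
  also have "\<dots> = ennreal (t * c)"
    using assms by (simp add: ennreal_mult)
  finally show ?thesis
    using assms by (simp add: ennreal_le_iff)
qed

lemma ennreal_mult_le_inverse:
  fixes m z :: ennreal
  assumes "K > 0" "z \<le> 1 / (ennreal K * m)"
  shows "m * z \<le> ennreal (1 / K)"
proof -
  have "m * z \<le> m * (1 / (ennreal K * m))"
    by (intro mult_left_mono assms) auto
  also have "\<dots> \<le> ennreal (1 / K)"
  \<comment> \<open>The degenerate values rest on \<open>ennreal\<close> conventions: for
    \<open>m = 0\<close> the quotient is infinite but its product with 0 is 0, and for infinite
    \<open>m\<close> the quotient is 0.\<close>
  proof (cases m)
    case (real r)
    then show ?thesis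
      using \<open>K > 0\<close>
      by (cases "r = 0")
        (auto simp: ennreal_mult [symmetric] divide_ennreal ennreal_1 [symmetric] simp del: ennreal_1)
  next
    case top
    then show ?thesis
      using \<open>K > 0\<close> by (simp add: ennreal_mult_top)
  qed
  finally show ?thesis .
qed

section \<open>The forward operators with all arguments equal\<close>

lemma forward_op_replicate_Suc:
  "forward_op \<Omega> k G u0 (Suc n) (replicate (Suc n) \<zeta>) x =
     a_op \<Omega> k G (forward_op \<Omega> k G u0 n (replicate n \<zeta>)) \<zeta> x +
     b_op \<Omega> k G (\<lambda>y. \<Sum>(i, j, l)\<in>triples n. forward_op \<Omega> k G u0 i (replicate i \<zeta>) y *
       forward_op \<Omega> k G u0 j (replicate j \<zeta>) y * forward_op \<Omega> k G u0 l (replicate l \<zeta>) y) \<zeta> x"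
proof -
  have [simp]: "butlast (replicate (Suc n) \<zeta>) = replicate n \<zeta>" "last (replicate (Suc n) \<zeta>) = \<zeta>"
    by (simp_all add: butlast_conv_take flip: replicate_Suc)
  have "(\<Sum>(i, j, l)\<in>triples n.
         tensor (i + j) (tensor i (forward_op \<Omega> k G u0 i) (forward_op \<Omega> k G u0 j))
           (forward_op \<Omega> k G u0 l) (replicate n \<zeta>) y) =
     (\<Sum>(i, j, l)\<in>triples n. forward_op \<Omega> k G u0 i (replicate i \<zeta>) y *
       forward_op \<Omega> k G u0 j (replicate j \<zeta>) y * forward_op \<Omega> k G u0 l (replicate l \<zeta>) y)" for y
    \<comment> \<open>\<open>take\<close> and \<open>drop\<close> cut a constant list into constant
      lists of lengths \<open>i\<close>, \<open>j\<close> and \<open>l\<close>, so the splitting of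
      arguments in \<open>tensor\<close> disappears.\<close>
    by (rule sum.cong) (auto simp: triples_def tensor_def min_def)
  then show ?thesis
    by (simp add: A_op_def B_op_def del: replicate_Suc)
qed

text \<open>The induction is strong because the cubic term involves all lower orders. Continuity is
  carried along both to apply \<open>cont\<close> at the next order and to extend the bound to the
  boundary.\<close>

lemma forward_op_bound:
  fixes \<Omega> :: "'a::euclidean_space set"
  assumes "open \<Omega>" and u0: "continuous_on (closure \<Omega>) u0" "\<And>x. x \<in> closure \<Omega> \<Longrightarrow> \<bar>u0 x\<bar> \<le> c"
    and "c \<ge> 0" "t \<ge> 0"
    and G: "\<And>x. x \<in> \<Omega> \<Longrightarrow> G x \<in> borel_measurable (lebesgue_on \<Omega>)"
    and \<zeta>: "mu \<Omega> k G * coeff_norm \<Omega> \<zeta> \<le> ennreal t"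
    and cont: "\<And>v. continuous_on (closure \<Omega>) v \<Longrightarrow>
          continuous_on (closure \<Omega>) (a_op \<Omega> k G v \<zeta>) \<and> continuous_on (closure \<Omega>) (b_op \<Omega> k G v \<zeta>)"
  shows "continuous_on (closure \<Omega>) (forward_op \<Omega> k G u0 n (replicate n \<zeta>)) \<and>
    (\<forall>x\<in>closure \<Omega>. \<bar>forward_op \<Omega> k G u0 n (replicate n \<zeta>) x\<bar> \<le> nu_seq c n * t ^ n)"
proof (induction n rule: less_induct)
  case (less n)
  define f where "f i = forward_op \<Omega> k G u0 i (replicate i \<zeta>)" for i
  show ?case
  proof (cases n)
    case 0
    then show ?thesis using u0 by simp
  next
    case (Suc m)
    have f_cont: "continuous_on (closure \<Omega>) (f i)"
      and f_le: "x \<in> closure \<Omega> \<Longrightarrow> \<bar>f i x\<bar> \<le> nu_seq c i * t ^ i" if "i \<le> m" for i x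
      using less that Suc by (auto simp: f_def)
    define S where "S y = (\<Sum>(i, j, l)\<in>triples m. f i y * f j y * f l y)" for y
    define B where "B = (\<Sum>(i, j, l)\<in>triples m.
      (nu_seq c i * t ^ i) * (nu_seq c j * t ^ j) * (nu_seq c l * t ^ l))"
    have f_Suc: "f n x = a_op \<Omega> k G (f m) \<zeta> x + b_op \<Omega> k G S \<zeta> x" for x
      unfolding f_def S_def [abs_def] Suc by (rule forward_op_replicate_Suc)
    have S_cont: "continuous_on (closure \<Omega>) S"
      unfolding S_def [abs_def] case_prod_unfold
      by (intro continuous_intros f_cont) (auto simp: triples_def)
    have S_le: "\<bar>S y\<bar> \<le> B" if "y \<in> closure \<Omega>" for y
    proof -
      have "\<bar>f i y * f j y * f l y\<bar> \<le>
          (nu_seq c i * t ^ i) * (nu_seq c j * t ^ j) * (nu_seq c l * t ^ l)"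
        if "(i, j, l) \<in> triples m" for i j l
        unfolding abs_mult using that \<open>y \<in> closure \<Omega>\<close> assms
        by (intro mult_mono f_le mult_nonneg_nonneg nu_seq_nonneg) (auto simp: triples_def)
      then show ?thesis
        unfolding S_def B_def by (intro order_trans [OF sum_abs] sum_mono) auto
    qed
    have "B \<ge> 0"
      unfolding B_def using assms
      by (intro sum_nonneg) (auto intro!: mult_nonneg_nonneg nu_seq_nonneg)
    have n_cont: "continuous_on (closure \<Omega>) (f n)"
      unfolding f_Suc [abs_def] using cont f_cont S_cont by (intro continuous_on_add) auto
    \<comment> \<open>The supremum in \<open>mu\<close> ranges over \<Omega> alone, so the estimate
      is first made at points of \<Omega>.\<close>
    have "\<bar>f n x\<bar> \<le> nu_seq c n * t ^ n" if "x \<in> \<Omega>" for x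
    proof -
      have \<zeta>_le: "mu \<Omega> k G * Linf_norm \<Omega> (fst \<zeta>) \<le> ennreal t"
        "mu \<Omega> k G * Linf_norm \<Omega> (snd \<zeta>) \<le> ennreal t"
        by (rule order_trans [OF _ \<zeta>], rule mult_left_mono, auto simp: coeff_norm_def)+
      have mem: "y \<in> closure \<Omega>" if "y \<in> \<Omega>" for y
        using that closure_subset by blast
      have "\<bar>a_op \<Omega> k G (f m) \<zeta> x\<bar> \<le> t * (nu_seq c m * t ^ m)"
        unfolding a_op_def using assms that \<zeta>_le
        by (intro abs_integral_operator_le f_le mem mult_nonneg_nonneg nu_seq_nonneg) auto
      moreover have "\<bar>b_op \<Omega> k G S \<zeta> x\<bar> \<le> t * B"
        unfolding b_op_def using assms that \<zeta>_le \<open>B \<ge> 0\<close>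
        by (intro abs_integral_operator_le S_le mem) auto
      \<comment> \<open>The recursion of \<open>nu_seq\<close> is designed for this: its linear term
        majorizes the \<open>A\<close> part and its triple sum the \<open>B\<close> part.\<close>
      moreover have "nu_seq c n * t ^ n = t * (nu_seq c m * t ^ m) + t * B"
        unfolding Suc nu_seq_Suc_weighted B_def by (simp only: distrib_left)
      ultimately show ?thesis
        unfolding f_Suc by linarith
    qed
    then have "\<bar>f n x\<bar> \<le> nu_seq c n * t ^ n" if "x \<in> closure \<Omega>" for x
      by (rule continuous_le_on_closure [OF continuous_on_rabs [OF n_cont] that])
    then show ?thesis
      using n_cont by (simp add: f_def)
  qed
qed

section \<open>Uniform convergence of the Born series\<close>

lemma abs_le_C_norm:
  assumes "bounded \<Omega>" "continuous_on (closure \<Omega>) v" "x \<in> closure \<Omega>"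
  shows "\<bar>v x\<bar> \<le> C_norm \<Omega> v"
proof -
  have "compact ((\<lambda>x. \<bar>v x\<bar>) ` closure \<Omega>)"
    using assms by (intro compact_continuous_image continuous_intros) auto
  then show ?thesis
    unfolding C_norm_def using assms(3)
    by (intro cSUP_upper bounded_imp_bdd_above compact_imp_bounded)
qed

theorem mainTheorem4:
  fixes \<Omega> :: "(real ^ 'd) set"
    and k :: real
    and G :: "real ^ 'd \<Rightarrow> real ^ 'd \<Rightarrow> real"
    and u0 g :: "real ^ 'd \<Rightarrow> real"
  assumes dim: "CARD('d) > 2"
    and domain: "smooth_bounded_domain \<Omega>"
    and k_pos: "k > 0"
    and u0: "background_field \<Omega> k g u0"
    and G: "greens_function \<Omega> k G"
    and G_integrable: "\<And>x. x \<in> closure \<Omega> \<Longrightarrow> integrable (lebesgue_on \<Omega>) (G x)"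
    and ab_continuous: "\<And>v \<zeta>. continuous_on (closure \<Omega>) v \<Longrightarrow> \<zeta> \<in> Linf \<Omega> \<times> Linf \<Omega> \<Longrightarrow>
          continuous_on (closure \<Omega>) (a_op \<Omega> k G v \<zeta>) \<and>
          continuous_on (closure \<Omega>) (b_op \<Omega> k G v \<zeta>)"
  shows "(\<exists>\<nu> K. K > 0 \<and> (\<forall>n. nu_seq (C_norm \<Omega> u0) n \<le> \<nu> * K ^ n)) \<and>
    (\<forall>\<nu> K. K > 0 \<and> (\<forall>n. nu_seq (C_norm \<Omega> u0) n \<le> \<nu> * K ^ n) \<longrightarrow>
      (\<forall>\<zeta> \<in> Linf \<Omega> \<times> Linf \<Omega>. coeff_norm \<Omega> \<zeta> \<le> 1 / (ennreal K * mu \<Omega> k G) \<longrightarrow>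
        (\<forall>n. continuous_on (closure \<Omega>) (forward_op \<Omega> k G u0 n (replicate n \<zeta>))) \<and>
        (\<exists>u. continuous_on (closure \<Omega>) u \<and>
           uniform_limit (closure \<Omega>)
             (\<lambda>N x. u0 x + (\<Sum>n=1..N. forward_op \<Omega> k G u0 n (replicate n \<zeta>) x)) u
             sequentially)))"
proof -
  let ?c = "C_norm \<Omega> u0"
  have "open \<Omega>" "bounded \<Omega>" "\<Omega> \<noteq> {}"
    using domain by (auto simp: smooth_bounded_domain_def)
  have u0_cont: "continuous_on (closure \<Omega>) u0"
    using u0 by (simp add: background_field_def)
  have u0_le: "\<bar>u0 x\<bar> \<le> ?c" if "x \<in> closure \<Omega>" for x
    using \<open>bounded \<Omega>\<close> u0_cont that by (rule abs_le_C_norm)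
  have c: "?c \<ge> 0"
    using \<open>\<Omega> \<noteq> {}\<close> u0_le closure_subset by (meson abs_ge_zero all_not_in_conv order_trans subsetD)
  have series: "(\<forall>n. continuous_on (closure \<Omega>) (forward_op \<Omega> k G u0 n (replicate n \<zeta>))) \<and>
        (\<exists>u. continuous_on (closure \<Omega>) u \<and>
           uniform_limit (closure \<Omega>)
             (\<lambda>N x. u0 x + (\<Sum>n=1..N. forward_op \<Omega> k G u0 n (replicate n \<zeta>) x)) u
             sequentially)"
    if K: "K > 0" "\<forall>n. nu_seq ?c n \<le> \<nu> * K ^ n"
      and \<zeta>: "\<zeta> \<in> Linf \<Omega> \<times> Linf \<Omega>" "coeff_norm \<Omega> \<zeta> \<le> 1 / (ennreal K * mu \<Omega> k G)"
    for \<nu> K \<zeta>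
  proof -
    define f where "f n = forward_op \<Omega> k G u0 n (replicate n \<zeta>)" for n
    have "continuous_on (closure \<Omega>) (f n) \<and> (\<forall>x\<in>closure \<Omega>. \<bar>f n x\<bar> \<le> nu_seq ?c n * (1 / K) ^ n)" for n
      unfolding f_def
    proof (rule forward_op_bound)
      show "G x \<in> borel_measurable (lebesgue_on \<Omega>)" if "x \<in> \<Omega>" for x
        using G_integrable [of x] that closure_subset by auto
      show "mu \<Omega> k G * coeff_norm \<Omega> \<zeta> \<le> ennreal (1 / K)"
        using K \<zeta> by (intro ennreal_mult_le_inverse)
    qed (use \<open>open \<Omega>\<close> u0_cont u0_le c K \<zeta> ab_continuous in auto)
    then have f_cont: "continuous_on (closure \<Omega>) (f n)"
      and f_le: "x \<in> closure \<Omega> \<Longrightarrow> norm (f n x) \<le> nu_seq ?c n * (1 / K) ^ n" for n x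
      by auto
    have summ: "summable (\<lambda>n. nu_seq ?c n * (1 / K) ^ n)"
      using c K by (intro summable_nu_seq_endpoint) auto
    define u where "u x = (\<Sum>n. f n x)" for x
    \<comment> \<open>Endpoint summability supplies a Weierstrass majorant independent of the point,
      also when the norm of the coefficients attains the radius.\<close>
    have "uniform_limit (closure \<Omega>) (\<lambda>N x. \<Sum>n<N. f n x) u sequentially"
      unfolding u_def [abs_def] using f_le summ by (rule Weierstrass_m_test)
    \<comment> \<open>Shifting the index by one aligns the sums over \<open>n < N\<close> with the
      stated form, where the term of order 0 is split off as \<open>u0\<close>.\<close>
    then have "uniform_limit (closure \<Omega>) (\<lambda>N x. \<Sum>n<Suc N. f n x) u sequentially"
      by (rule filterlim_compose [OF _ filterlim_Suc])
    also have "(\<lambda>N x. \<Sum>n<Suc N. f n x) = (\<lambda>N x. u0 x + (\<Sum>n=1..N. f n x))"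
      by (simp add: f_def lessThan_Suc_atMost sum.atMost_shift sum.atLeast1_atMost_eq fun_eq_iff)
    finally have lim: "uniform_limit (closure \<Omega>) (\<lambda>N x. u0 x + (\<Sum>n=1..N. f n x)) u sequentially" .
    have "continuous_on (closure \<Omega>) u"
      by (rule uniform_limit_theorem [OF _ lim])
        (auto intro!: always_eventually continuous_intros u0_cont f_cont)
    with lim f_cont show ?thesis
      unfolding f_def by blast
  qed
  show ?thesis
    using nu_seq_exponential_bound [OF c] series by blast
qed

end
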